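(* The set of all pairs of integers $(x,y)\in\mathbb{Z}^2$ satisfying $2xy^2+y(-3x+3)-x(3x-1)=0$ is $$\{(1,-1),\,(9,-3),\,(2,2),\,(1,1),\,(0,0),\,(-1,2),\,(-1,1)\}.$$ *)

theory Defs
  imports Main
begin

end

theory Submission
  imports Defs
begin

text \<open>
  Read as a quadratic in \<open>x\<close>, the equation is \<open>3x\<^sup>2 - A x = 3y\<close> with
  \<open>A = (2y - 1)(y - 1)\<close>, so \<open>x\<close> and \<open>d = 3x - A\<close> are complementary divisors of \<open>3y\<close>.
  If \<open>y \<noteq> 0\<close>, two integers with product \<open>3y\<close> cannot be large, which makes
  \<open>A = 3x - d\<close> at most linear in \<open>\<bar>y\<bar>\<close> (lemma \<open>weighted_divisor_sum_le\<close>);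
  but \<open>A\<close> grows quadratically. Hence \<open>y\<close> is bounded, then so is \<open>x\<close>, a divisor of \<open>3y\<close>,
  and only a small box of candidates remains (lemma \<open>solutions_in_box\<close>).
  If \<open>y = 0\<close>, the equation is \<open>x(3x - 1) = 0\<close>, whose only integer root is \<open>0\<close>.
\<close>

text \<open>
  For a fixed product \<open>x d\<close>, the left-hand side is largest when \<open>\<bar>d\<bar> = 1\<close>:
  the gap in this inequality is \<open>(\<bar>d\<bar> - 1)(3\<bar>x\<bar> - 1)\<close>.
\<close>
lemma weighted_divisor_sum_le:
  fixes x d :: int
  assumes "x * d \<noteq> 0"
  shows "3 * \<bar>x\<bar> + \<bar>d\<bar> \<le> 3 * \<bar>x * d\<bar> + 1"
proof -
  have "0 \<le> (\<bar>d\<bar> - 1) * (3 * \<bar>x\<bar> - 1)"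
    using assms by (intro mult_nonneg_nonneg) auto
  then show ?thesis
    by (simp add: algebra_simps abs_mult)
qed

lemma solution_bounds:
  fixes x y :: int
  assumes eq: "x * (3 * x - (2 * y - 1) * (y - 1)) = 3 * y" and "y \<noteq> 0"
  shows "-3 \<le> y \<and> y \<le> 6 \<and> -18 \<le> x \<and> x \<le> 18"
proof -
  define d where "d = 3 * x - (2 * y - 1) * (y - 1)"
  have xd: "x * d = 3 * y"
    using eq by (simp add: d_def)
  have "2 * (y * y) - 3 * y + 1 = 3 * x - d"
    by (simp add: d_def algebra_simps)
  also have "\<dots> \<le> 3 * \<bar>x\<bar> + \<bar>d\<bar>"
    by simp
  also have "\<dots> \<le> 9 * \<bar>y\<bar> + 1"
    using weighted_divisor_sum_le[of x d] xd \<open>y \<noteq> 0\<close> by simp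
  finally have le: "2 * (y * y) \<le> 3 * y + 9 * \<bar>y\<bar>"
    by simp
  \<comment> \<open>The right-hand side is \<open>12y\<close> for positive \<open>y\<close>, but only \<open>-6y\<close> for negative \<open>y\<close>.\<close>
  have y_bounds: "-3 \<le> y \<and> y \<le> 6"
  proof (cases "y > 0")
    case True
    then have "y * y \<le> y * 6"
      using le by simp
    then show ?thesis
      using True by simp
  next
    case False
    then have "y * y \<le> y * (-3)"
      using le by simp
    then show ?thesis
      using mult_le_cancel_left_neg[of y y "-3"] False \<open>y \<noteq> 0\<close> by linarith
  qed
  have "\<bar>x\<bar> \<le> \<bar>3 * y\<bar>"
    using dvd_imp_le_int[of "3 * y" x] xd \<open>y \<noteq> 0\<close> by (metis dvd_triv_left mult_eq_0_iff zero_neq_numeral)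
  then show ?thesis
    using y_bounds by auto
qed

lemma solutions_in_box:
  "\<forall>y \<in> set [-3..6 :: int]. \<forall>x \<in> set [-18..18 :: int].
    x * (3 * x - (2 * y - 1) * (y - 1)) = 3 * y \<longrightarrow>
    (x, y) \<in> {(1, -1), (9, -3), (2, 2), (1, 1), (0, 0), (-1, 2), (-1, 1)}"
  by (simp add: upto.simps)

theorem theorem4p2:
  shows "{(x :: int, y :: int). 2 * x * y ^ 2 + y * (- 3 * x + 3) - x * (3 * x - 1) = 0} =
    {(1, -1), (9, -3), (2, 2), (1, 1), (0, 0), (-1, 2), (-1, 1)}"
  (is "?S = ?T")
proof
  show "?S \<subseteq> ?T"
  proof (rule subrelI)
    fix x y :: int
    assume "(x, y) \<in> ?S"
    then have eq: "x * (3 * x - (2 * y - 1) * (y - 1)) = 3 * y"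
      by (simp add: algebra_simps power2_eq_square)
    show "(x, y) \<in> ?T"
    proof (cases "y = 0")
      case True
      then have "x * (3 * x - 1) = 0"
        using eq by simp
      moreover have "3 * x - 1 \<noteq> 0"
        by presburger
      ultimately show ?thesis
        using True by simp
    next
      case False
      then have "y \<in> set [-3..6]" "x \<in> set [-18..18]"
        using solution_bounds[OF eq] unfolding set_upto by auto
      then show ?thesis
        using solutions_in_box eq by blast
    qed
  qed
  show "?T \<subseteq> ?S"
    by simp
qed

end
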